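(* Let $(z_n)$ be a finite or infinite sequence of non-zero complex numbers in the angle $|\mathrm{Arg}(z_n)|\le\frac{\pi}{8}$ such that $$\sum_n\frac{1}{|z_n|^2}<\infty.$$ Then there exists a symmetric (about zero) strictly subgaussian distribution on $\mathbb{R}$ whose characteristic function $f(z)=\mathbb{E}\,e^{izX}$, $z\in\mathbb{C}$ (where $X$ has this distribution), has zeros exactly at the points $\pm z_n$, $\pm\bar z_n$.
   Context: A random variable $X$ (or its distribution) is called strictly subgaussian if $\mathbb{E}\,e^{tX}\le e^{\sigma^2t^2/2}$ for all $t\in\mathbb{R}$ with $\sigma^2=\mathrm{Var}(X)$; in this case its characteristic function extends to an entire function $f(z)=\mathbb{E}\,e^{izX}$ on $\mathbb{C}$. $\mathrm{Arg}$ is the principal argument, with values in $(-\pi,\pi]$. *)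

theory Defs
  imports "HOL-Probability.Probability" "HOL-Library.Extended_Nat"
begin

(* Integrability is required explicitly because the Bochner integral of a non-integrable function
   is 0. Finiteness of all exponential moments makes X square integrable, so variance X is the
   genuine (finite) variance. *)
definition (in prob_space) strictly_subgaussian :: "('a \<Rightarrow> real) \<Rightarrow> bool" where
  "strictly_subgaussian X \<longleftrightarrow>
     random_variable borel X \<and>
     (\<forall>t::real. integrable M (\<lambda>\<omega>. exp (t * X \<omega>)) \<and>
        expectation (\<lambda>\<omega>. exp (t * X \<omega>)) \<le> exp (variance X * t\<^sup>2 / 2))"

definition symmetric_distr :: "real measure \<Rightarrow> bool" where
  "symmetric_distr M \<longleftrightarrow> distr M borel uminus = M"

(* Extends the library's char from real to complex arguments. Meaningful when the integrand is
   integrable, which holds for every z if M is strictly subgaussian. *)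
definition complex_char :: "real measure \<Rightarrow> complex \<Rightarrow> complex" where
  "complex_char M z = (CLINT x|M. exp (\<i> * z * complex_of_real x))"

lemma complex_char_of_real: "complex_char M (complex_of_real t) = char M t"
  by (simp add: complex_char_def char_def mult.assoc)

end

theory Submission
  imports Defs "HOL-Real_Asymp.Real_Asymp"
begin

text \<open>
  Put \<open>c\<^sub>n = 1 / z\<^sub>n\<^sup>2\<close>. The distribution is an infinite convolution of symmetric laws, the \<open>n\<close>-th of which
  has the characteristic function
    \<open>(1 - c\<^sub>n w\<^sup>2) (1 - cnj c\<^sub>n w\<^sup>2) exp (- 5 |c\<^sub>n| w\<^sup>2 / 2)\<close>,
  whose zeros are the four points \<open>\<plusminus> z\<^sub>n\<close>, \<open>\<plusminus> cnj z\<^sub>n\<close>. Three facts make this work.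

  \<^item> The factor is a characteristic function. Multiplying a Gaussian characteristic function by an even
    quartic amounts to multiplying the Gaussian density by a combination of the Hermite polynomials of
    degrees 0, 2 and 4, and for a Gaussian of variance \<open>5 |c\<^sub>n|\<close> this combination is nonnegative because
    \<open>Re c\<^sub>n\<close> is comparable to \<open>|c\<^sub>n|\<close> (lemma \<open>quad_factor_is_complex_char\<close>).

  \<^item> The factor is strictly subgaussian. Its moment generating function is
    \<open>(1 + 2 Re c\<^sub>n t\<^sup>2 + |c\<^sub>n|\<^sup>2 t\<^sup>4) exp (5 |c\<^sub>n| t\<^sup>2 / 2)\<close> and its variance is \<open>4 Re c\<^sub>n + 5 |c\<^sub>n|\<close>, so what is
    needed is \<open>1 + a + b \<le> exp a\<close> with \<open>a = 2 Re c\<^sub>n t\<^sup>2\<close> and \<open>b = |c\<^sub>n|\<^sup>2 t\<^sup>4\<close>. This follows from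
    \<open>1 + a + a\<^sup>2 / 2 \<le> exp a\<close> as soon as \<open>|c\<^sub>n|\<^sup>2 \<le> 2 (Re c\<^sub>n)\<^sup>2\<close>, that is, as soon as the argument of
    \<open>z\<^sub>n\<^sup>2\<close> is at most \<open>\<pi> / 4\<close> in modulus. The angle \<open>\<pi> / 8\<close> enters here
    (lemmas \<open>Re_inverse_square_ge\<close> and \<open>quad_mgf_bounds\<close>).

  \<^item> The infinite convolution exists. The moment generating functions of the partial convolutions are
    bounded by \<open>exp (s t\<^sup>2 / 2)\<close>, where the total variance \<open>s\<close> is finite because the \<open>|c\<^sub>n|\<close> are summable.
    This gives tightness, hence a weak limit point, and also the uniform integrability that carries
    the convergence of characteristic functions from the real line to the whole plane (lemma
    \<open>complex_char_limit_exists\<close>). The limiting infinite product converges in the strict sense, so that it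
    vanishes only where one of its factors does.

  The variance of the limit is never computed from the construction. The two-sided estimate
  \<open>1 + s t\<^sup>2 / 2 \<le> E exp (t X) \<le> exp (s t\<^sup>2 / 2)\<close> survives the limit, and its left half, read as \<open>t\<close> tends to 0,
  says that the variance is at least \<open>s\<close>; with the right half this is strict subgaussianity.
\<close>

section \<open>Gaussian moments with a complex exponential weight\<close>

lemma abs_power_le_fact_exp: "\<bar>x\<bar> ^ k \<le> fact k * exp \<bar>x::real\<bar>"
proof -
  have "\<bar>x\<bar> ^ k / fact k \<le> (\<Sum>n. \<bar>x\<bar> ^ n /\<^sub>R fact n)"
    using sum_le_suminf[of "\<lambda>n. \<bar>x\<bar> ^ n /\<^sub>R fact n" "{k}"] summable_exp_generic[of "\<bar>x\<bar>"]
    by (simp add: field_simps)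
  then show ?thesis
    by (simp add: exp_def field_simps)
qed

lemma exp_abs_le_exp_add_exp: "exp \<bar>x::real\<bar> \<le> exp x + exp (- x)"
  by (cases "x \<ge> 0") auto

lemma normal_density_exp_shift:
  "exp (a * x) * std_normal_density x = exp (a\<^sup>2 / 2) * normal_density a 1 x"
  by (simp add: normal_density_def exp_add [symmetric] power2_eq_square field_simps)

lemma integrable_exp_std_normal: "integrable lborel (\<lambda>x. exp (a * x) * std_normal_density x)"
  unfolding normal_density_exp_shift by (intro integrable_mult_right integrable_normal_density) auto

abbreviation gauss_moment_integrand :: "nat \<Rightarrow> complex \<Rightarrow> real \<Rightarrow> complex" where
  "gauss_moment_integrand k z x \<equiv> of_real (x ^ k) * exp (z * of_real x) * of_real (std_normal_density x)"

lemma norm_gauss_moment_integrand_le: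
  "norm (gauss_moment_integrand k z x)
     \<le> fact k * (exp ((Re z + 1) * x) + exp ((Re z - 1) * x)) * std_normal_density x"
proof -
  have "norm (gauss_moment_integrand k z x) = \<bar>x\<bar> ^ k * exp (Re z * x) * std_normal_density x"
    by (simp add: norm_mult norm_power)
  also have "\<dots> \<le> (fact k * (exp x + exp (- x))) * exp (Re z * x) * std_normal_density x"
    by (intro mult_right_mono order_trans[OF abs_power_le_fact_exp] mult_left_mono exp_abs_le_exp_add_exp) auto
  also have "\<dots> = fact k * (exp ((Re z + 1) * x) + exp ((Re z - 1) * x)) * std_normal_density x"
    by (simp add: algebra_simps exp_add [symmetric])
  finally show ?thesis .
qed

lemma integrable_gauss_moment: "integrable lborel (gauss_moment_integrand k z)"
proof (rule Bochner_Integration.integrable_bound)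
  show "integrable lborel (\<lambda>x. fact k * (exp ((Re z + 1) * x) * std_normal_density x
          + exp ((Re z - 1) * x) * std_normal_density x))"
    by (intro integrable_mult_right Bochner_Integration.integrable_add integrable_exp_std_normal)
  show "AE x in lborel. norm (gauss_moment_integrand k z x) \<le> norm (fact k *
          (exp ((Re z + 1) * x) * std_normal_density x + exp ((Re z - 1) * x) * std_normal_density x))"
    using norm_gauss_moment_integrand_le by (auto simp: algebra_simps intro!: order_trans[OF _ abs_ge_self])
qed auto

text \<open>
  The characteristic function of the normal law gives this for imaginary \<open>z\<close>. The factor \<open>exp (Re z * x)\<close>
  is absorbed by completing the square, which translates the density by \<open>Re z\<close>.
\<close>

lemma integral_exp_std_normal: "(\<integral>x. gauss_moment_integrand 0 z x \<partial>lborel) = exp (z\<^sup>2 / 2)"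
proof -
  define a b where "a = Re z" and "b = Im z"
  have z: "z = of_real a + \<i> * of_real b"
    by (simp add: a_def b_def complex_eq)
  have char_int: "(\<integral>y. exp (\<i> * of_real (b * y)) * of_real (std_normal_density y) \<partial>lborel)
      = of_real (exp (- (b\<^sup>2) / 2))"
    using fun_cong[OF char_std_normal_distribution, of b]
    by (simp add: char_def integral_density scaleR_conv_of_real mult.commute)
  have shift: "gauss_moment_integrand 0 z (a + 1 * y)
      = exp (z * of_real a - of_real (a\<^sup>2 / 2)) *
        (exp (\<i> * of_real (b * y)) * of_real (std_normal_density y))" for y
  proof -
    have "std_normal_density (a + y) = exp (- a * y - a\<^sup>2 / 2) * std_normal_density y"
      by (simp add: normal_density_def exp_add [symmetric] power2_eq_square field_simps)
    then have "gauss_moment_integrand 0 z (a + 1 * y)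
        = exp (z * of_real (a + y)) * exp (of_real (- a * y - a\<^sup>2 / 2)) * of_real (std_normal_density y)"
      by (simp only: exp_of_real) simp
    also have "exp (z * of_real (a + y)) * exp (of_real (- a * y - a\<^sup>2 / 2))
        = exp (z * of_real a - of_real (a\<^sup>2 / 2)) * exp (\<i> * of_real (b * y))"
      unfolding exp_add [symmetric] by (simp add: z algebra_simps)
    finally show ?thesis by (simp add: mult_ac)
  qed
  have "(\<integral>x. gauss_moment_integrand 0 z x \<partial>lborel)
      = exp (z * of_real a - of_real (a\<^sup>2 / 2)) * of_real (exp (- (b\<^sup>2) / 2))"
    by (subst lborel_integral_real_affine[of 1 _ a]) (simp_all only: shift integral_mult_right_zero char_int, simp_all)
  also have "\<dots> = exp (z * of_real a - of_real (a\<^sup>2 / 2) + of_real (- (b\<^sup>2) / 2))"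
    by (simp only: exp_of_real [symmetric] exp_add)
  also have "z * of_real a - of_real (a\<^sup>2 / 2) + of_real (- (b\<^sup>2) / 2) = z\<^sup>2 / 2"
    by (simp add: z power2_eq_square algebra_simps add_divide_distrib diff_divide_distrib)
  finally show ?thesis .
qed

lemma integral_derivative_eq_0_if_vanishing_at_infinity:
  fixes F f :: "real \<Rightarrow> 'a::euclidean_space"
  assumes "\<And>x. (F has_vector_derivative f x) (at x)" "\<And>x. isCont f x" "integrable lborel f"
    and "(F \<longlongrightarrow> 0) at_top" "(F \<longlongrightarrow> 0) at_bot"
  shows "integral\<^sup>L lborel f = 0"
proof -
  have "(LBINT x=-\<infinity>..\<infinity>. f x) = 0 - 0"
    using assms
    by (intro interval_integral_FTC_integrable[where F = F])
       (auto simp: ereal_tendsto_simps set_integrable_def)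
  then show ?thesis
    by (simp add: interval_lebesgue_integral_def set_lebesgue_integral_def)
qed

lemma gauss_moment_integrand_tendsto_0:
  assumes "F = at_top \<or> F = at_bot"
  shows "(gauss_moment_integrand k z \<longlongrightarrow> 0) F"
proof (rule Lim_null_comparison)
  show "\<forall>\<^sub>F x in F. norm (gauss_moment_integrand k z x)
      \<le> fact k * (exp ((Re z + 1) * x) + exp ((Re z - 1) * x)) * std_normal_density x"
    by (intro always_eventually allI norm_gauss_moment_integrand_le)
  have "((\<lambda>x. exp (a * x) * std_normal_density x) \<longlongrightarrow> 0) F" for a
  proof (rule Lim_null_comparison)
    have "a * x - x\<^sup>2 / 2 \<le> a\<^sup>2 - x\<^sup>2 / 4" for x
      using sum_squares_ge_zero[of "a - x / 2" 0] by (simp add: power2_eq_square algebra_simps)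
    then have "exp (a * x) * exp (- x\<^sup>2 / 2) \<le> exp (a\<^sup>2) * exp (- x\<^sup>2 / 4)" for x
      unfolding exp_add [symmetric] by simp
    from mult_left_mono[OF this, of "1 / sqrt (2 * pi)"]
    show "\<forall>\<^sub>F x in F. norm (exp (a * x) * std_normal_density x)
        \<le> 1 / sqrt (2 * pi) * (exp (a\<^sup>2) * exp (- x\<^sup>2 / 4))"
      by (intro always_eventually allI) (simp add: std_normal_density_def mult_ac)
    have "((\<lambda>x::real. exp (- x\<^sup>2 / 4)) \<longlongrightarrow> 0) at_top" "((\<lambda>x::real. exp (- x\<^sup>2 / 4)) \<longlongrightarrow> 0) at_bot"
      by real_asymp+
    then have "((\<lambda>x::real. exp (- x\<^sup>2 / 4)) \<longlongrightarrow> 0) F"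
      using assms by blast
    then show "((\<lambda>x. 1 / sqrt (2 * pi) * (exp (a\<^sup>2) * exp (- x\<^sup>2 / 4))) \<longlongrightarrow> 0) F"
      by (intro tendsto_mult_right_zero)
  qed
  from tendsto_mult_left[OF tendsto_add[OF this[of "Re z + 1"] this[of "Re z - 1"]], of "fact k"]
  show "((\<lambda>x. fact k * (exp ((Re z + 1) * x) + exp ((Re z - 1) * x)) * std_normal_density x) \<longlongrightarrow> 0) F"
    by (simp add: algebra_simps)
qed

text \<open>
  Integration by parts, using that the normal density satisfies \<open>\<phi>' x = - x * \<phi> x\<close>. The index \<open>k - 1\<close> is
  harmless for \<open>k = 0\<close>, where its coefficient vanishes.
\<close>

lemma gauss_moment_Suc:
  "(\<integral>x. gauss_moment_integrand (Suc k) z x \<partial>lborel)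
     = z * (\<integral>x. gauss_moment_integrand k z x \<partial>lborel)
       + of_nat k * (\<integral>x. gauss_moment_integrand (k - 1) z x \<partial>lborel)"
proof -
  let ?g = gauss_moment_integrand
  define f where "f x = z * ?g k z x + of_nat k * ?g (k - 1) z x - ?g (Suc k) z x" for x
  have "(?g k z has_vector_derivative f x) (at x)" for x
  proof -
    have dens: "(std_normal_density has_real_derivative - x * std_normal_density x) (at x)"
    proof -
      define C where "C = 1 / sqrt (2 * pi)"
      show ?thesis
        unfolding std_normal_density_def C_def [symmetric] by (auto intro!: derivative_eq_intros)
    qed
    have e: "((\<lambda>x. exp (z * of_real x)) has_vector_derivative z * exp (z * of_real x)) (at x)"
      by (rule has_vector_derivative_real_field) (auto intro!: derivative_eq_intros)
    have p: "((\<lambda>x. of_real (x ^ k)) has_vector_derivative of_real (of_nat k * x ^ (k - 1))) (at x :: real filter)"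
      by (intro has_vector_derivative_of_real) 
         (auto intro!: derivative_eq_intros simp: has_real_derivative_iff_has_vector_derivative [symmetric])
    show ?thesis
      by (rule has_vector_derivative_eq_rhs[OF has_vector_derivative_mult[OF has_vector_derivative_mult[OF p e]
            has_vector_derivative_of_real[OF dens]]])
         (simp add: f_def algebra_simps)
  qed
  moreover have "isCont f x" for x
    unfolding f_def normal_density_def by (intro continuous_intros) auto
  moreover have "integrable lborel f"
    unfolding f_def
    by (intro Bochner_Integration.integrable_diff Bochner_Integration.integrable_add
          integrable_mult_right integrable_gauss_moment)
  ultimately have "integral\<^sup>L lborel f = 0"
    by (rule integral_derivative_eq_0_if_vanishing_at_infinity)
       (rule gauss_moment_integrand_tendsto_0, simp)+
  moreover have "integral\<^sup>L lborel f = z * integral\<^sup>L lborel (?g k z)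
      + of_nat k * integral\<^sup>L lborel (?g (k - 1) z) - integral\<^sup>L lborel (?g (Suc k) z)"
    unfolding f_def
    by (simp only: Bochner_Integration.integral_diff Bochner_Integration.integral_add
          integral_mult_right_zero integrable_mult_right integrable_gauss_moment
          Bochner_Integration.integrable_add)
  ultimately show ?thesis by simp
qed

section \<open>A distribution whose characteristic function has four prescribed zeros\<close>

text \<open>
  The two polynomials are the Hermite polynomials of degrees 2 and 4. Multiplying the normal density by
  them multiplies its two-sided Laplace transform by \<open>z\<^sup>2\<close> and \<open>z\<^sup>4\<close>.
\<close>

definition hermite_density :: "real \<Rightarrow> real \<Rightarrow> real \<Rightarrow> real" where
  "hermite_density \<alpha> \<beta> x = (1 + \<alpha> * (x\<^sup>2 - 1) + \<beta> * (x ^ 4 - 6 * x\<^sup>2 + 3)) * std_normal_density x"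

lemma hermite_density_nonneg:
  assumes "0 \<le> \<beta>" "6 * \<beta> \<le> \<alpha>" "\<alpha> \<le> 1 + 3 * \<beta>"
  shows "0 \<le> hermite_density \<alpha> \<beta> x"
proof -
  have "1 + \<alpha> * (x\<^sup>2 - 1) + \<beta> * (x ^ 4 - 6 * x\<^sup>2 + 3)
      = (1 - \<alpha> + 3 * \<beta>) + (\<alpha> - 6 * \<beta>) * x\<^sup>2 + \<beta> * x ^ 4"
    by (simp add: algebra_simps)
  moreover have "\<dots> \<ge> 0"
  proof -
    have "0 \<le> 1 - \<alpha> + 3 * \<beta>" "0 \<le> \<alpha> - 6 * \<beta>"
      using assms by simp_all
    with assms(1) show ?thesis
      by (simp del: diff_ge_0_iff_ge)
  qed
  ultimately show ?thesis
    by (simp add: hermite_density_def)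
qed

lemma has_integral_exp_hermite_density:
  fixes z :: complex
  shows "has_bochner_integral lborel (\<lambda>x. exp (z * of_real x) * of_real (hermite_density \<alpha> \<beta> x))
     ((1 + of_real \<alpha> * z\<^sup>2 + of_real \<beta> * z ^ 4) * exp (z\<^sup>2 / 2))"
proof -
  let ?g = gauss_moment_integrand
  have eq: "(\<lambda>x. exp (z * of_real x) * of_real (hermite_density \<alpha> \<beta> x))
     = (\<lambda>x. of_real (1 - \<alpha> + 3 * \<beta>) * ?g 0 z x + of_real (\<alpha> - 6 * \<beta>) * ?g 2 z x + of_real \<beta> * ?g 4 z x)"
    by (auto simp: hermite_density_def algebra_simps)
  have I0: "integral\<^sup>L lborel (?g 0 z) = exp (z\<^sup>2 / 2)"
    by (rule integral_exp_std_normal)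
  have I1: "integral\<^sup>L lborel (?g 1 z) = z * exp (z\<^sup>2 / 2)"
    using gauss_moment_Suc[of 0 z] I0 by simp
  have I2: "integral\<^sup>L lborel (?g 2 z) = (z\<^sup>2 + 1) * exp (z\<^sup>2 / 2)"
    using gauss_moment_Suc[of 1 z] I0 I1 by (simp add: power2_eq_square algebra_simps numeral_2_eq_2)
  have I3: "integral\<^sup>L lborel (?g 3 z) = (z ^ 3 + 3 * z) * exp (z\<^sup>2 / 2)"
    using gauss_moment_Suc[of 2 z] I1 I2 by (simp add: power2_eq_square power3_eq_cube algebra_simps)
  have I4: "integral\<^sup>L lborel (?g 4 z) = (z ^ 4 + 6 * z\<^sup>2 + 3) * exp (z\<^sup>2 / 2)"
    using gauss_moment_Suc[of 3 z] I2 I3 by (simp add: eval_nat_numeral algebra_simps)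
  have h: "has_bochner_integral lborel (?g k z) I" if "integral\<^sup>L lborel (?g k z) = I" for k I
    using that by (simp only: has_bochner_integral_iff integrable_gauss_moment simp_thms)
  have "has_bochner_integral lborel
      (\<lambda>x. of_real (1 - \<alpha> + 3 * \<beta>) * ?g 0 z x + of_real (\<alpha> - 6 * \<beta>) * ?g 2 z x + of_real \<beta> * ?g 4 z x)
      (of_real (1 - \<alpha> + 3 * \<beta>) * exp (z\<^sup>2 / 2) + of_real (\<alpha> - 6 * \<beta>) * ((z\<^sup>2 + 1) * exp (z\<^sup>2 / 2))
        + of_real \<beta> * ((z ^ 4 + 6 * z\<^sup>2 + 3) * exp (z\<^sup>2 / 2)))"
    by (intro has_bochner_integral_add has_bochner_integral_mult_right h I0 I2 I4)
  then show ?thesis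
    unfolding eq by (simp add: algebra_simps)
qed

text \<open>
  Finiteness of all exponential moments makes the characteristic function meaningful on the whole
  complex plane; it is the class of distributions in which the construction takes place.
\<close>

definition has_exp_moments :: "real measure \<Rightarrow> bool" where
  "has_exp_moments M \<longleftrightarrow> real_distribution M \<and> (\<forall>t::real. integrable M (\<lambda>x. exp (t * x)))"

text \<open>
  For \<open>c = 1 / z\<^sup>2\<close> the zeros are \<open>\<plusminus> z\<close> and \<open>\<plusminus> cnj z\<close>. Parametrising by \<open>c\<close> instead of \<open>z\<close> lets \<open>c = 0\<close> stand for
  an absent factor, so that finite sequences of zeros need no separate treatment.
\<close>

definition quad_factor :: "complex \<Rightarrow> complex \<Rightarrow> complex" where
  "quad_factor c w = (1 - w\<^sup>2 * c) * (1 - w\<^sup>2 * cnj c) * exp (of_real (- 5 / 2 * cmod c) * w\<^sup>2)"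

text \<open>
  The law is that of \<open>sqrt \<gamma> * Y\<close>, where \<open>Y\<close> has a Hermite-perturbed normal density. The constant 5 in
  \<open>\<gamma> = 5 |c|\<close> makes \<open>\<beta> = 1/25\<close> and puts \<open>\<alpha>\<close> between \<open>sqrt 2 / 5 \<ge> 6 \<beta>\<close> and \<open>2/5 \<le> 1 + 3 \<beta>\<close>, the range in which
  that density is nonnegative; a constant below \<open>3 sqrt 2\<close> would be too small. For \<open>c = 0\<close> division by zero gives
  \<open>\<alpha> = \<beta> = 0\<close>, and the scaling by \<open>0\<close> turns the law into the point mass at the origin.
\<close>

lemma quad_factor_is_complex_char:
  assumes "sqrt 2 / 2 * cmod c \<le> Re c"
  shows "\<exists>M. has_exp_moments M \<and> complex_char M = quad_factor c"
proof -
  define \<gamma> where "\<gamma> = 5 * cmod c"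
  define \<alpha> where "\<alpha> = 2 * Re c / \<gamma>"
  define \<beta> where "\<beta> = (cmod c)\<^sup>2 / \<gamma>\<^sup>2"
  have \<beta>0: "0 \<le> \<beta>" by (simp add: \<beta>_def)
  \<comment> \<open>This is \<open>6 * \<beta> \<le> \<alpha>\<close> in the extreme case \<open>Re c = sqrt 2 / 2 * cmod c\<close>.\<close>
  have s: "6 / 5 \<le> sqrt (2::real)"
    by (rule real_le_rsqrt) (simp add: power2_eq_square)
  have \<alpha>\<beta>: "6 * \<beta> \<le> \<alpha> \<and> \<alpha> \<le> 1 + 3 * \<beta>"
  proof (cases "c = 0")
    case False
    then have c: "cmod c > 0" by simp
    have \<beta>: "\<beta> = 1 / 25"
      using c by (simp add: \<beta>_def \<gamma>_def power2_eq_square)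
    have "6 / 5 * cmod c \<le> 2 * Re c"
      using mult_right_mono[OF s, of "cmod c"] assms by simp
    then have "6 * \<beta> \<le> \<alpha>"
      using c unfolding \<beta> \<alpha>_def \<gamma>_def by (simp add: field_simps)
    moreover have "2 * Re c \<le> 5 * cmod c"
      using complex_Re_le_cmod[of c] c by linarith
    then have "\<alpha> \<le> 1"
      using c unfolding \<alpha>_def \<gamma>_def by (simp add: field_simps)
    ultimately show ?thesis using \<beta>0 by simp
  qed (simp add: \<alpha>_def \<beta>_def \<gamma>_def)
  define p where "p = hermite_density \<alpha> \<beta>"
  have p0: "p x \<ge> 0" for x
    using hermite_density_nonneg[OF \<beta>0] \<alpha>\<beta> by (simp add: p_def)
  have [measurable]: "p \<in> borel_measurable borel"
    unfolding p_def hermite_density_def by measurable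
  have int: "has_bochner_integral lborel (\<lambda>x. exp (z * of_real x) * of_real (p x))
     ((1 + of_real \<alpha> * z\<^sup>2 + of_real \<beta> * z ^ 4) * exp (z\<^sup>2 / 2))" for z :: complex
    unfolding p_def by (rule has_integral_exp_hermite_density)
  have "has_bochner_integral lborel (\<lambda>x. complex_of_real (p x)) (complex_of_real 1)"
    using int[of 0] by simp
  then have int1: "has_bochner_integral lborel p 1"
    unfolding has_bochner_integral_iff complex_of_real_integrable_eq integral_complex_of_real of_real_eq_iff .
  define N where "N = density lborel (\<lambda>x. ennreal (p x))"
  interpret N: prob_space N
  proof
    have "(\<integral>\<^sup>+x. ennreal (p x) \<partial>lborel) = ennreal 1"
      using int1 p0 by (subst nn_integral_eq_integral) (auto simp: has_bochner_integral_iff)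
    then show "emeasure N (space N) = 1"
      by (simp add: N_def emeasure_density)
  qed
  define M where "M = distr N borel (\<lambda>y. sqrt \<gamma> * y)"
  have [measurable_cong]: "sets N = sets borel" by (simp add: N_def)
  have M: "real_distribution M"
    unfolding M_def by (intro N.real_distribution_distr) measurable
  have E: "has_bochner_integral M (\<lambda>x. exp (z * of_real x))
      ((1 + of_real \<alpha> * (z * sqrt \<gamma>)\<^sup>2 + of_real \<beta> * (z * sqrt \<gamma>) ^ 4) * exp ((z * sqrt \<gamma>)\<^sup>2 / 2))" for z :: complex
    unfolding M_def N_def
    by (intro has_bochner_integral_distr has_bochner_integral_density)
       (use int[of "z * sqrt \<gamma>"] p0 in \<open>auto simp: scaleR_conv_of_real mult_ac\<close>)
  have "integrable M (\<lambda>x. exp (t * x))" for t :: real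
  proof -
    have "integrable M (\<lambda>x. complex_of_real (exp (t * x)))"
      using E[of "of_real t"] by (simp add: has_bochner_integral_iff exp_of_real [symmetric])
    then show ?thesis
      by (simp add: complex_of_real_integrable_eq)
  qed
  moreover have "complex_char M w = quad_factor c w" for w
  proof -
    have g0: "\<gamma> \<ge> 0" by (simp add: \<gamma>_def)
    have sq: "(\<i> * w * sqrt \<gamma>)\<^sup>2 = - w\<^sup>2 * of_real \<gamma>"
      using g0 by (simp add: power_mult_distrib of_real_power [symmetric] del: of_real_power)
    have sq4: "(\<i> * w * sqrt \<gamma>) ^ 4 = w ^ 4 * of_real (\<gamma>\<^sup>2)"
      using arg_cong[OF sq, of "\<lambda>x. x\<^sup>2"] by (simp add: power_mult_distrib)
    have a: "\<alpha> * \<gamma> = 2 * Re c"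
      by (cases "c = 0") (auto simp: \<alpha>_def \<gamma>_def)
    have b: "\<beta> * \<gamma>\<^sup>2 = (cmod c)\<^sup>2"
      by (cases "c = 0") (auto simp: \<beta>_def \<gamma>_def)
    have "complex_char M w = (1 - of_real (\<alpha> * \<gamma>) * w\<^sup>2 + of_real (\<beta> * \<gamma>\<^sup>2) * w ^ 4) * exp (- w\<^sup>2 * of_real \<gamma> / 2)"
      using E[of "\<i> * w"] unfolding complex_char_def sq sq4 
      by (simp add: has_bochner_integral_iff mult_ac)
    also have "1 - of_real (\<alpha> * \<gamma>) * w\<^sup>2 + of_real (\<beta> * \<gamma>\<^sup>2) * w ^ 4 = (1 - w\<^sup>2 * c) * (1 - w\<^sup>2 * cnj c)"
      unfolding a b complex_add_cnj [symmetric] complex_norm_square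
      by (simp add: algebra_simps power2_eq_square eval_nat_numeral)
    also have "- w\<^sup>2 * of_real \<gamma> / 2 = of_real (- 5 / 2 * cmod c) * w\<^sup>2"
      by (simp add: \<gamma>_def)
    finally show ?thesis by (simp add: quad_factor_def)
  qed
  ultimately show ?thesis
    using M unfolding has_exp_moments_def by blast
qed

section \<open>Convolutions\<close>

lemma has_exp_moments_integrable_complex:
  assumes "has_exp_moments M"
  shows "integrable M (\<lambda>x. exp (z * complex_of_real x))"
proof (rule Bochner_Integration.integrable_bound)
  interpret real_distribution M
    using assms by (simp add: has_exp_moments_def)
  show "integrable M (\<lambda>x. exp (Re z * x))"
    using assms by (simp add: has_exp_moments_def)
  show "(\<lambda>x. exp (z * complex_of_real x)) \<in> borel_measurable M"
    by measurable
qed auto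

lemma (in pair_sigma_finite)
  fixes f :: "'a \<Rightarrow> 'c::{real_normed_field, banach, second_countable_topology}"
  assumes f: "integrable M1 f" and g: "integrable M2 g"
  shows integrable_pair_mult: "integrable (M1 \<Otimes>\<^sub>M M2) (\<lambda>p. f (fst p) * g (snd p))"
    and integral_pair_mult: "(\<integral>p. f (fst p) * g (snd p) \<partial>(M1 \<Otimes>\<^sub>M M2)) = integral\<^sup>L M1 f * integral\<^sup>L M2 g"
proof -
  have [measurable]: "f \<in> borel_measurable M1" "g \<in> borel_measurable M2"
    using f g by auto
  show int: "integrable (M1 \<Otimes>\<^sub>M M2) (\<lambda>p. f (fst p) * g (snd p))"
    by (rule Fubini_integrable) (use f g in \<open>auto simp: norm_mult\<close>)
  from integral_fst'[OF this] show "(\<integral>p. f (fst p) * g (snd p) \<partial>(M1 \<Otimes>\<^sub>M M2)) = integral\<^sup>L M1 f * integral\<^sup>L M2 g"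
    by simp
qed

lemma
  assumes M: "has_exp_moments M" and N: "has_exp_moments N"
  shows has_exp_moments_convolution: "has_exp_moments (M \<star> N)"
    and complex_char_convolution: "complex_char (M \<star> N) w = complex_char M w * complex_char N w"
proof -
  interpret M: real_distribution M using M by (simp add: has_exp_moments_def)
  interpret N: real_distribution N using N by (simp add: has_exp_moments_def)
  interpret pair_prob_space M N ..
  have conv: "M \<star> N = distr (M \<Otimes>\<^sub>M N) borel (\<lambda>p. fst p + snd p)"
    by (simp add: convolution_def case_prod_beta')
  have "real_distribution (M \<star> N)"
    unfolding conv by (intro P.real_distribution_distr) measurable
  moreover have "integrable (M \<star> N) (\<lambda>x. exp (t * x))" for t :: real
    using integrable_pair_mult[of "\<lambda>x. exp (t * x)" "\<lambda>x. exp (t * x)"] M N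
    by (simp add: conv integrable_distr_eq has_exp_moments_def distrib_left exp_add)
  ultimately show "has_exp_moments (M \<star> N)"
    by (simp add: has_exp_moments_def)
  show "complex_char (M \<star> N) w = complex_char M w * complex_char N w"
    using integral_pair_mult[OF has_exp_moments_integrable_complex[OF M, of "\<i> * w"]
        has_exp_moments_integrable_complex[OF N, of "\<i> * w"]]
    by (simp add: complex_char_def conv integral_distr distrib_left exp_add)
qed

section \<open>Weak limits of distributions with exponential moments\<close>

text \<open>
  Weak convergence only controls integrals of bounded functions. A uniform bound on the second moment of
  \<open>g\<close> makes \<open>g\<close> uniformly integrable: cutting its modulus off at height \<open>K\<close> changes each integral by at
  most \<open>C / K\<close>. The bound itself passes to the limit by monotone convergence of truncations.
\<close>

lemma weak_conv_integral_if_square_bounded: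
  fixes g :: "real \<Rightarrow> complex"
  assumes \<mu>: "\<And>n. real_distribution (\<mu> n)" and M: "real_distribution M" and weak: "weak_conv_m \<mu> M"
    and cont: "\<And>x. isCont g x"
    and int: "\<And>n. integrable (\<mu> n) (\<lambda>x. (cmod (g x))\<^sup>2)"
    and bound: "\<And>n. (\<integral>x. (cmod (g x))\<^sup>2 \<partial>\<mu> n) \<le> C"
  shows "integrable M g" and "(\<lambda>n. integral\<^sup>L (\<mu> n) g) \<longlonglongrightarrow> integral\<^sup>L M g"
proof -
  interpret \<mu>: real_distribution "\<mu> n" for n by (rule \<mu>)
  interpret M: real_distribution M by (rule M)
  note conv = weak_conv_imp_integral_bdd_continuous_conv[OF \<mu> M weak]
  have [measurable]: "g \<in> borel_measurable borel"
    using cont by (intro borel_measurable_continuous_onI continuous_at_imp_continuous_on) auto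

  have C0: "0 \<le> C"
    using bound[of 0] by (rule order_trans[rotated]) simp
  define m where "m k x = min ((cmod (g x))\<^sup>2) (real k)" for k x
  have [measurable]: "m k \<in> borel_measurable borel" for k
    unfolding m_def by measurable
  have m_int: "integrable N (m k)" if "real_distribution N" for N k
  proof -
    interpret real_distribution N by (rule that)
    show ?thesis
      by (rule integrable_const_bound[where B = "real k"]) (auto simp: m_def)
  qed
  have m_bound: "integral\<^sup>L M (m k) \<le> C" for k
  proof (rule LIMSEQ_le_const2)
    show "(\<lambda>n. integral\<^sup>L (\<mu> n) (m k)) \<longlonglongrightarrow> integral\<^sup>L M (m k)"
    proof (rule conv[where B = "real k"])
      show "isCont (m k) x" for x
        unfolding m_def[abs_def] by (intro continuous_intros cont)
    qed (auto simp: m_def)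
    have "integral\<^sup>L (\<mu> n) (m k) \<le> (\<integral>x. (cmod (g x))\<^sup>2 \<partial>\<mu> n)" for n
      by (intro integral_mono m_int int \<mu>) (auto simp: m_def)
    with bound show "\<exists>N. \<forall>n\<ge>N. integral\<^sup>L (\<mu> n) (m k) \<le> C"
      by (meson order_trans)
  qed
  have m_inc: "incseq (\<lambda>k. integral\<^sup>L M (m k))"
    by (intro incseq_SucI integral_mono m_int M) (auto simp: m_def)
  from incseq_convergent[OF this, of C] m_bound obtain L
    where L: "(\<lambda>k. integral\<^sup>L M (m k)) \<longlonglongrightarrow> L" by blast
  have L_le: "L \<le> C"
    using L m_bound by (intro LIMSEQ_le_const2[OF L]) auto
  have m_lim: "(\<lambda>k. m k x) \<longlonglongrightarrow> (cmod (g x))\<^sup>2" for x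
  proof (rule tendsto_eventually)
    obtain K where "(cmod (g x))\<^sup>2 \<le> real K" using real_arch_simple by blast
    then show "\<forall>\<^sub>F k in sequentially. m k x = (cmod (g x))\<^sup>2"
      unfolding eventually_sequentially m_def by (intro exI[of _ K]) auto
  qed
  have hM: "has_bochner_integral M (\<lambda>x. (cmod (g x))\<^sup>2) L"
    by (rule has_bochner_integral_monotone_convergence[OF m_int[OF M] _ AE_I2[OF m_lim] L])
       (auto simp: mono_def m_def)
  have intM: "integrable M (\<lambda>x. (cmod (g x))\<^sup>2)" and boundM: "(\<integral>x. (cmod (g x))\<^sup>2 \<partial>M) \<le> C"
    using hM L_le by (auto simp: has_bochner_integral_iff)

  have g_int: "integrable N g" if "real_distribution N" "integrable N (\<lambda>x. (cmod (g x))\<^sup>2)" for N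
  proof -
    interpret real_distribution N by (rule that)
    have "cmod (g x) \<le> 1 + (cmod (g x))\<^sup>2" for x
    proof -
      have "2 * cmod (g x) \<le> (cmod (g x))\<^sup>2 + 1"
        using zero_le_power2[of "cmod (g x) - 1"] by (simp add: power2_diff)
      with norm_ge_zero[of "g x"] show ?thesis by linarith
    qed
    then have "AE x in N. cmod (g x) \<le> norm (1 + (cmod (g x))\<^sup>2)"
      by (intro AE_I2) (simp only: real_norm_def, rule order_trans[OF _ abs_ge_self])
    moreover have "integrable N (\<lambda>x. 1 + (cmod (g x))\<^sup>2)"
      by (intro Bochner_Integration.integrable_add integrable_const that)
    ultimately show ?thesis
      by (rule Bochner_Integration.integrable_bound[rotated 2]) measurable
  qed
  show "integrable M g" by (intro g_int M intM)

  \<comment> \<open>The radial projection of \<open>g\<close> onto the disc of radius \<open>K\<close>, which is continuous, unlike \<open>g\<close> times an indicator.\<close>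
  define T where "T K x = g x * of_real (K / max K (cmod (g x)))" for K x
  have [measurable]: "T K \<in> borel_measurable borel" for K
    unfolding T_def by measurable
  have T_norm: "cmod (T K x) \<le> K" if "K > 0" for K x
    using that by (auto simp: T_def norm_mult norm_divide divide_simps max_def)
  have T_cont: "isCont (T K) x" if "K > 0" for K x
    using that unfolding T_def by (intro continuous_intros cont) (auto simp: max_def)
  have T_diff: "cmod (g x - T K x) \<le> (cmod (g x))\<^sup>2 / K" if "K > 0" for K x
  proof (cases "cmod (g x) \<le> K")
    case True
    then show ?thesis using that by (simp add: T_def max_def)
  next
    case False
    then have "g x - T K x = g x * of_real (1 - K / cmod (g x))"
      by (simp add: T_def max_def algebra_simps)
    then have "cmod (g x - T K x) = cmod (g x) * \<bar>1 - K / cmod (g x)\<bar>"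
      by (simp only: norm_mult norm_of_real)
    also have "\<dots> \<le> cmod (g x) * 1"
      using False that by (intro mult_left_mono) (auto simp: divide_simps)
    also have "\<dots> \<le> (cmod (g x))\<^sup>2 / K"
      using False that mult_right_mono[of K "cmod (g x)" "cmod (g x)"]
      by (simp add: field_simps power2_eq_square)
    finally show ?thesis .
  qed
  have close: "cmod (integral\<^sup>L N g - integral\<^sup>L N (T K)) \<le> C / K"
    if N: "real_distribution N" "integrable N (\<lambda>x. (cmod (g x))\<^sup>2)" "(\<integral>x. (cmod (g x))\<^sup>2 \<partial>N) \<le> C"
      and K: "K > 0" for N K
  proof -
    interpret real_distribution N by (rule N)
    have T_int: "integrable N (T K)"
      by (rule integrable_const_bound[where B = K]) (use T_norm K in auto)
    have "cmod (integral\<^sup>L N g - integral\<^sup>L N (T K)) = cmod (\<integral>x. g x - T K x \<partial>N)"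
      using g_int[OF N(1,2)] T_int by simp
    also have "\<dots> \<le> (\<integral>x. (cmod (g x))\<^sup>2 / K \<partial>N)"
      using g_int[OF N(1,2)] T_int T_diff[OF K] N(2) by (intro Bochner_Integration.integral_norm_bound_integral) auto
    also have "\<dots> \<le> C / K"
      using N(3) K by (simp add: divide_right_mono)
    finally show ?thesis .
  qed
  show "(\<lambda>n. integral\<^sup>L (\<mu> n) g) \<longlonglongrightarrow> integral\<^sup>L M g"
  proof (rule LIMSEQ_I)
    fix \<epsilon> :: real assume \<epsilon>: "0 < \<epsilon>"
    define K where "K = (3 * C + 1) / \<epsilon>"
    have K: "K > 0" using C0 \<epsilon> by (simp add: K_def)
    have CK: "C / K < \<epsilon> / 3" using C0 \<epsilon> by (simp add: K_def field_simps)
    have "(\<lambda>n. integral\<^sup>L (\<mu> n) (T K)) \<longlonglongrightarrow> integral\<^sup>L M (T K)"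
      by (rule conv[where B = K]) (use T_norm T_cont K in auto)
    from LIMSEQ_D[OF this, of "\<epsilon> / 3"] \<epsilon> obtain n0
      where n0: "\<And>n. n \<ge> n0 \<Longrightarrow> cmod (integral\<^sup>L (\<mu> n) (T K) - integral\<^sup>L M (T K)) < \<epsilon> / 3" by auto
    have "cmod (integral\<^sup>L (\<mu> n) g - integral\<^sup>L M g) < \<epsilon>" if "n \<ge> n0" for n
    proof -
      let ?x = "integral\<^sup>L (\<mu> n) g" and ?a = "integral\<^sup>L (\<mu> n) (T K)"
      let ?y = "integral\<^sup>L M g" and ?b = "integral\<^sup>L M (T K)"
      have "cmod (?x - ?y) = cmod ((?x - ?a) + (?a - ?b) - (?y - ?b))"
        by simp
      also have "\<dots> \<le> cmod (?x - ?a) + cmod (?a - ?b) + cmod (?y - ?b)"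
        by (intro order_trans[OF norm_triangle_ineq4] add_right_mono norm_triangle_ineq)
      also have "\<dots> < \<epsilon>"
        using close[OF \<mu> int bound K, of n] close[OF M intM boundM K] n0[OF that] CK by linarith
      finally show ?thesis .
    qed
    then show "\<exists>n0. \<forall>n\<ge>n0. cmod (integral\<^sup>L (\<mu> n) g - integral\<^sup>L M g) < \<epsilon>" by blast
  qed
qed

text \<open>Markov's inequality for \<open>exp x + exp (- x)\<close>, which dominates \<open>|x|\<close>.\<close>

lemma tight_if_exp_moments_bounded:
  assumes \<mu>: "\<And>n. has_exp_moments (\<mu> n)"
    and B: "\<And>n t. (\<integral>x. exp (t * x) \<partial>\<mu> n) \<le> B t"
  shows "tight \<mu>"
  unfolding tight_def
proof (intro conjI allI impI)
  show rd: "real_distribution (\<mu> n)" for n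
    using \<mu>[of n] by (simp add: has_exp_moments_def)
  fix \<epsilon> :: real assume \<epsilon>: "\<epsilon> > 0"
  define C where "C = B 1 + B (- 1)"
  have C: "(\<integral>x. exp x + exp (- x) \<partial>\<mu> n) \<le> C" for n
    using B[of n 1] B[of n "- 1"] \<mu>[of n]
    by (subst Bochner_Integration.integral_add) 
       (auto simp: C_def has_exp_moments_def dest: spec[of _ 1] spec[of _ "- 1"])
  have C0: "0 \<le> C"
    using C[of 0] by (rule order_trans[rotated]) simp
  define K where "K = (C + 1) / \<epsilon>"
  have K: "K > 0" using C0 \<epsilon> by (simp add: K_def)
  have CK: "C / K < \<epsilon>" using C0 \<epsilon> by (simp add: K_def field_simps)
  have "1 - \<epsilon> < measure (\<mu> n) {- K<..K}" for n
  proof -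
    interpret real_distribution "\<mu> n" by (rule rd)
    let ?A = "{x \<in> space (\<mu> n). exp x + exp (- x) \<ge> K}"
    have int: "integrable (\<mu> n) (\<lambda>x. exp x + exp (- x))"
      using \<mu>[of n] by (intro Bochner_Integration.integrable_add)
        (auto simp: has_exp_moments_def dest: spec[of _ 1] spec[of _ "- 1"])
    have "prob ?A \<le> (\<integral>x. exp x + exp (- x) \<partial>\<mu> n) / K"
      by (rule integral_Markov_inequality_measure[OF int, of "{}"]) (use K in auto)
    also have "\<dots> \<le> C / K"
      using C K by (simp add: divide_right_mono)
    finally have A: "prob ?A < \<epsilon>" using CK by simp
    have "x \<in> {- K<..K}" if "x \<notin> ?A" for x
    proof -
      have "\<bar>x\<bar> < exp \<bar>x\<bar>" 
        using exp_ge_add_one_self[of "\<bar>x\<bar>"] by linarith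
      also have "\<dots> < K"
        using that exp_abs_le_exp_add_exp[of x] by simp
      finally show ?thesis by auto
    qed
    then have "prob (space (\<mu> n) - ?A) \<le> prob {- K<..K}"
      by (intro finite_measure_mono) (blast, simp)
    moreover have "prob (space (\<mu> n) - ?A) = 1 - prob ?A"
      by (intro prob_compl) measurable
    ultimately show ?thesis using A by simp
  qed
  with K show "\<exists>a b. a < b \<and> (\<forall>n. 1 - \<epsilon> < measure (\<mu> n) {a<..b})"
    by (intro exI[of _ "- K"] exI[of _ K]) auto
qed

text \<open>
  A version of Levy's continuity theorem on the complex plane. The bound on the exponential moments
  yields a weakly convergent subsequence by tightness, and it bounds the second moment of
  \<open>exp (z * x)\<close>, whose square modulus is again a real exponential, so that the integrals converge for every
  complex \<open>z\<close>.
\<close>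

lemma complex_char_limit_exists:
  assumes \<mu>: "\<And>n. has_exp_moments (\<mu> n)"
    and B: "\<And>n t. (\<integral>x. exp (t * x) \<partial>\<mu> n) \<le> B t"
    and lim: "\<And>w. (\<lambda>n. complex_char (\<mu> n) w) \<longlonglongrightarrow> f w"
  shows "\<exists>M. has_exp_moments M \<and> complex_char M = f"
proof -
  have "\<exists>r M. strict_mono r \<and> real_distribution M \<and> weak_conv_m (\<mu> \<circ> id \<circ> r) M"
    by (rule tight_imp_convergent_subsubsequence[OF tight_if_exp_moments_bounded[OF \<mu> B] strict_mono_id])
  then obtain r M where r: "strict_mono r" and M: "real_distribution M" and weak: "weak_conv_m (\<mu> \<circ> id \<circ> r) M"
    by (elim exE conjE) (rule that)
  have key: "integrable M (\<lambda>x. exp (z * complex_of_real x))"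
    "(\<lambda>n. (\<integral>x. exp (z * complex_of_real x) \<partial>\<mu> (r n))) \<longlonglongrightarrow> (\<integral>x. exp (z * complex_of_real x) \<partial>M)" for z
  proof -
    have sq: "(cmod (exp (z * complex_of_real x)))\<^sup>2 = exp (2 * Re z * x)" for x
      by (simp add: power2_eq_square mult_exp_exp)
    have w: "weak_conv_m (\<lambda>n. \<mu> (r n)) M"
      using weak by (simp add: comp_def)
    have rd: "real_distribution (\<mu> (r n))" for n
      using \<mu> by (simp add: has_exp_moments_def)
    have i: "integrable (\<mu> (r n)) (\<lambda>x. (cmod (exp (z * complex_of_real x)))\<^sup>2)" for n
      unfolding sq using \<mu>[of "r n"] by (simp add: has_exp_moments_def)
    have b: "(\<integral>x. (cmod (exp (z * complex_of_real x)))\<^sup>2 \<partial>\<mu> (r n)) \<le> B (2 * Re z)" for n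
      unfolding sq by (rule B)
    have c: "isCont (\<lambda>x. exp (z * complex_of_real x)) x" for x
      by (intro continuous_intros)
    show "integrable M (\<lambda>x. exp (z * complex_of_real x))"
      "(\<lambda>n. (\<integral>x. exp (z * complex_of_real x) \<partial>\<mu> (r n))) \<longlonglongrightarrow> (\<integral>x. exp (z * complex_of_real x) \<partial>M)"
      by (rule weak_conv_integral_if_square_bounded[OF rd M w c i b])+
  qed
  have "integrable M (\<lambda>x. exp (t * x))" for t :: real
  proof -
    have "integrable M (\<lambda>x. complex_of_real (exp (t * x)))"
      using key(1)[of "of_real t"] by (simp add: exp_of_real [symmetric])
    then show ?thesis by (simp add: complex_of_real_integrable_eq)
  qed
  with M have "has_exp_moments M" by (simp add: has_exp_moments_def)
  moreover have "complex_char M w = f w" for w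
  proof (rule LIMSEQ_unique)
    show "(\<lambda>n. complex_char (\<mu> (r n)) w) \<longlonglongrightarrow> complex_char M w"
      using key(2)[of "\<i> * w"] by (simp add: complex_char_def)
    show "(\<lambda>n. complex_char (\<mu> (r n)) w) \<longlonglongrightarrow> f w"
      using LIMSEQ_subseq_LIMSEQ[OF lim r] by (simp add: comp_def)
  qed
  ultimately show ?thesis by blast
qed

section \<open>Symmetry and variance from the complex characteristic function\<close>

lemma abs_power_le_exp_sum: "\<bar>x\<bar> ^ k \<le> fact k * (exp x + exp (- x))" for x :: real
  by (rule order_trans[OF abs_power_le_fact_exp mult_left_mono[OF exp_abs_le_exp_add_exp]]) simp

lemma has_exp_moments_integrable_power:
  assumes "has_exp_moments M"
  shows "integrable M (\<lambda>x. x ^ k)"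
proof (rule Bochner_Integration.integrable_bound)
  interpret real_distribution M
    using assms by (simp add: has_exp_moments_def)
  have "integrable M (\<lambda>x. exp (1 * x))" "integrable M (\<lambda>x. exp ((- 1) * x))"
    using assms unfolding has_exp_moments_def by blast+
  then show "integrable M (\<lambda>x. fact k * (exp x + exp (- x)))"
    by simp
  show "AE x in M. norm (x ^ k) \<le> norm (fact k * (exp x + exp (- x)))"
    using abs_power_le_exp_sum by (intro AE_I2) (simp add: power_abs order_trans[OF _ abs_ge_self])
  show "(\<lambda>x. x ^ k) \<in> borel_measurable M" by measurable
qed

lemma mgf_eq_complex_char:
  "complex_char M (- \<i> * of_real t) = of_real (\<integral>x. exp (t * x) \<partial>M)"
proof -
  have "exp (\<i> * (- \<i> * of_real t) * complex_of_real x) = of_real (exp (t * x))" for x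
    by (simp add: exp_of_real [symmetric])
  then show ?thesis
    by (simp only: complex_char_def integral_complex_of_real)
qed

lemma symmetric_distr_if_even_complex_char:
  assumes "real_distribution M" "\<And>w. complex_char M (- w) = complex_char M w"
  shows "symmetric_distr M"
proof -
  interpret real_distribution M by fact
  have "char (distr M borel uminus) t = char M t" for t
  proof -
    have "char (distr M borel uminus) t = char M (- t)"
      by (simp add: char_def integral_distr)
    also have "\<dots> = char M t"
      using assms(2)[of "of_real t"] complex_char_of_real[of M "- t"] complex_char_of_real[of M t] by simp
    finally show ?thesis .
  qed
  moreover have "real_distribution (distr M borel uminus)"
    by (intro real_distribution_distr) measurable
  ultimately show ?thesis
    unfolding symmetric_distr_def by (intro Levy_uniqueness assms(1)) auto
qed

lemma symmetric_distr_expectation_0: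
  assumes "real_distribution M" "symmetric_distr M"
  shows "(\<integral>x. x \<partial>M) = 0"
proof -
  interpret real_distribution M by fact
  have "(\<integral>x. x \<partial>M) = (\<integral>x. x \<partial>distr M borel uminus)"
    using assms(2) by (simp add: symmetric_distr_def)
  also have "\<dots> = - (\<integral>x. x \<partial>M)"
    by (subst integral_distr) auto
  finally show ?thesis by simp
qed

text \<open>Taylor's formula with the Lagrange remainder, whose factor 1/6 is dropped.\<close>

lemma exp_le_quadratic_remainder:
  fixes y :: real
  shows "exp y \<le> 1 + y + y\<^sup>2 / 2 + \<bar>y\<bar> ^ 3 * exp \<bar>y\<bar>"
proof -
  obtain \<xi> where \<xi>: "\<bar>\<xi>\<bar> \<le> \<bar>y\<bar>" and y: "exp y = (\<Sum>m<3. y ^ m / fact m) + exp \<xi> / fact 3 * y ^ 3"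
    using Maclaurin_exp_le[of y 3] by blast
  have "exp \<xi> / fact 3 * y ^ 3 \<le> exp \<xi> / fact 3 * \<bar>y\<bar> ^ 3"
    by (intro mult_left_mono) (simp_all add: power_abs [symmetric])
  also have "\<dots> \<le> exp \<bar>y\<bar> * \<bar>y\<bar> ^ 3"
  proof (rule mult_right_mono)
    have "exp \<xi> / fact 3 \<le> exp \<xi> / 1"
      by (intro divide_left_mono) (simp_all add: fact_numeral)
    also have "\<dots> \<le> exp \<bar>y\<bar>"
      using \<xi> by simp
    finally show "exp \<xi> / fact 3 \<le> exp \<bar>y\<bar>" .
  qed simp
  finally show ?thesis
    using y by (simp add: numeral_3_eq_3 power2_eq_square mult_ac)
qed

text \<open>
  Integrating the quadratic Taylor estimate of \<open>exp (t * x)\<close> gives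
  \<open>1 + s t\<^sup>2 / 2 \<le> 1 + t\<^sup>2 E X\<^sup>2 / 2 + C t\<^sup>3\<close> for \<open>0 < t \<le> 1\<close>. Divide by \<open>t\<^sup>2 / 2\<close> and let \<open>t\<close> tend to 0.
\<close>

lemma second_moment_ge_if_mgf_ge:
  assumes M: "has_exp_moments M" and mean: "(\<integral>x. x \<partial>M) = 0"
    and lower: "\<And>t. 1 + s * t\<^sup>2 / 2 \<le> (\<integral>x. exp (t * x) \<partial>M)"
  shows "s \<le> (\<integral>x. x\<^sup>2 \<partial>M)"
proof -
  interpret real_distribution M
    using M by (simp add: has_exp_moments_def)
  have e: "integrable M (\<lambda>x. exp (t * x))" for t
    using M by (simp add: has_exp_moments_def)
  note p = has_exp_moments_integrable_power[OF M]
  \<comment> \<open>A \<open>t\<close>-independent integrable majorant of the Taylor remainder.\<close>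
  define R where "R x = fact 3 * (exp (2 * x) + exp (- 2 * x))" for x :: real
  define C where "C = integral\<^sup>L M R"
  have R_int: "integrable M R"
    unfolding R_def using e by (intro integrable_mult_right Bochner_Integration.integrable_add)
  have R: "\<bar>x\<bar> ^ 3 * exp \<bar>x\<bar> \<le> R x" for x
  proof -
    have "\<bar>x\<bar> ^ 3 * exp \<bar>x\<bar> \<le> fact 3 * exp \<bar>x\<bar> * exp \<bar>x\<bar>"
      by (intro mult_right_mono abs_power_le_fact_exp) auto
    also have "\<dots> = fact 3 * exp \<bar>2 * x\<bar>"
      by (simp add: mult_exp_exp abs_mult)
    also have "\<dots> \<le> R x"
      unfolding R_def using exp_abs_le_exp_add_exp[of "2 * x"] by (intro mult_left_mono) auto
    finally show ?thesis .
  qed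
  have step: "s \<le> (\<integral>x. x\<^sup>2 \<partial>M) + 2 * C * t" if t: "0 < t" "t \<le> 1" for t
  proof -
    have pw: "exp (t * x) \<le> 1 + t * x + t\<^sup>2 / 2 * x\<^sup>2 + t ^ 3 * R x" for x
    proof -
      have "exp (t * x) \<le> 1 + t * x + (t * x)\<^sup>2 / 2 + \<bar>t * x\<bar> ^ 3 * exp \<bar>t * x\<bar>"
        by (rule exp_le_quadratic_remainder)
      also have "\<bar>t * x\<bar> ^ 3 * exp \<bar>t * x\<bar> \<le> t ^ 3 * (\<bar>x\<bar> ^ 3 * exp \<bar>x\<bar>)"
        using t mult_right_mono[of t 1 "\<bar>x\<bar>"]
        by (auto simp: abs_mult power_mult_distrib mult.assoc intro!: mult_left_mono)
      also have "\<dots> \<le> t ^ 3 * R x"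
        using t R by (intro mult_left_mono) auto
      finally show ?thesis by (simp add: power_mult_distrib)
    qed
    have "1 + s * t\<^sup>2 / 2 \<le> (\<integral>x. exp (t * x) \<partial>M)" by (rule lower)
    also have "\<dots> \<le> (\<integral>x. 1 + t * x + t\<^sup>2 / 2 * x\<^sup>2 + t ^ 3 * R x \<partial>M)"
      using p[of 1] p[of 2] R_int by (intro integral_mono e pw) auto
    also have "\<dots> = 1 + t\<^sup>2 / 2 * (\<integral>x. x\<^sup>2 \<partial>M) + t ^ 3 * C"
      using p[of 1] p[of 2] R_int mean prob_space by (simp add: C_def)
    finally have "t\<^sup>2 * s \<le> t\<^sup>2 * ((\<integral>x. x\<^sup>2 \<partial>M) + 2 * C * t)"
      by (simp add: algebra_simps power2_eq_square power3_eq_cube)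
    then show ?thesis using t by simp
  qed
  have "((\<lambda>t. (\<integral>x. x\<^sup>2 \<partial>M) + 2 * C * t) \<longlongrightarrow> (\<integral>x. x\<^sup>2 \<partial>M) + 2 * C * 0) (at_right 0)"
    by (intro tendsto_intros)
  then have lim: "((\<lambda>t. (\<integral>x. x\<^sup>2 \<partial>M) + 2 * C * t) \<longlongrightarrow> (\<integral>x. x\<^sup>2 \<partial>M)) (at_right 0)"
    by simp
  show ?thesis
  proof (rule tendsto_lowerbound[OF lim])
    show "\<forall>\<^sub>F t in at_right 0. s \<le> (\<integral>x. x\<^sup>2 \<partial>M) + 2 * C * t"
      unfolding eventually_at_right_field using step by (intro exI[of _ 1]) auto
  qed simp
qed

text \<open>
  The lower bound forces the variance to be at least \<open>s\<close>, so that replacing \<open>s\<close> by the variance weakens the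
  upper bound.
\<close>

lemma strictly_subgaussian_if_mgf_between:
  assumes M: "has_exp_moments M" and mean: "(\<integral>x. x \<partial>M) = 0"
    and lower: "\<And>t. 1 + s * t\<^sup>2 / 2 \<le> (\<integral>x. exp (t * x) \<partial>M)"
    and upper: "\<And>t. (\<integral>x. exp (t * x) \<partial>M) \<le> exp (s * t\<^sup>2 / 2)"
  shows "prob_space.strictly_subgaussian M (\<lambda>x. x)"
proof -
  interpret real_distribution M
    using M by (simp add: has_exp_moments_def)
  define V where "V = variance (\<lambda>x. x)"
  have sV: "s \<le> V"
    using second_moment_ge_if_mgf_ge[OF M mean lower] by (simp add: V_def mean)
  have "(\<integral>x. exp (t * x) \<partial>M) \<le> exp (V * t\<^sup>2 / 2)" for t
  proof (rule order_trans[OF upper])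
    have "s * t\<^sup>2 / 2 \<le> V * t\<^sup>2 / 2"
      by (intro divide_right_mono mult_right_mono sV) simp_all
    then show "exp (s * t\<^sup>2 / 2) \<le> exp (V * t\<^sup>2 / 2)"
      by (simp only: exp_le_cancel_iff)
  qed
  then show ?thesis
    unfolding strictly_subgaussian_def V_def [symmetric] using M by (auto simp: has_exp_moments_def)
qed

section \<open>Estimates for a single factor\<close>

text \<open>
  The argument of \<open>1 / z\<^sup>2\<close> is \<open>- 2 * Arg z\<close>, of modulus at most \<open>\<pi> / 4\<close>; the constant is \<open>cos (\<pi> / 4)\<close>.
\<close>

lemma Re_inverse_square_ge:
  assumes "z \<noteq> 0" "\<bar>Arg z\<bar> \<le> pi / 8"
  shows "sqrt 2 / 2 * cmod (1 / z\<^sup>2) \<le> Re (1 / z\<^sup>2)"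
proof -
  have "z\<^sup>2 = rcis ((cmod z)\<^sup>2) (2 * Arg z)"
    using DeMoivre2[of "cmod z" "Arg z" 2] by (simp add: rcis_cmod_Arg)
  then have "1 / z\<^sup>2 = rcis (1 / (cmod z)\<^sup>2) (- (2 * Arg z))"
    by (simp only: rcis_inverse divide_inverse mult_1)
  then have "Re (1 / z\<^sup>2) = cos (2 * Arg z) * cmod (1 / z\<^sup>2)"
    by (simp add: norm_divide norm_power)
  moreover have "cos (pi / 4) \<le> cos \<bar>2 * Arg z\<bar>"
    using assms(2) pi_gt_zero by (intro cos_monotone_0_pi_le) auto
  ultimately show ?thesis
    using mult_right_mono[of "sqrt 2 / 2" "cos (2 * Arg z)" "cmod (1 / z\<^sup>2)"] by (simp add: cos_45)
qed

text \<open>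
  The values of the factor on the imaginary axis, that is, the moment generating function of its law,
  and the variance of that law.
\<close>

definition quad_mgf :: "complex \<Rightarrow> real \<Rightarrow> real" where
  "quad_mgf c t = (1 + 2 * Re c * t\<^sup>2 + (cmod c)\<^sup>2 * t ^ 4) * exp (5 / 2 * cmod c * t\<^sup>2)"

definition quad_var :: "complex \<Rightarrow> real" where
  "quad_var c = 4 * Re c + 5 * cmod c"

lemma quad_factor_imaginary: "quad_factor c (- \<i> * of_real t) = of_real (quad_mgf c t)"
proof -
  have "(1 + of_real (t\<^sup>2) * c) * (1 + of_real (t\<^sup>2) * cnj c)
      = 1 + (c + cnj c) * of_real (t\<^sup>2) + c * cnj c * of_real (t ^ 4)"
    by (simp add: algebra_simps eval_nat_numeral)
  also have "\<dots> = of_real (1 + 2 * Re c * t\<^sup>2 + (cmod c)\<^sup>2 * t ^ 4)"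
    unfolding complex_add_cnj complex_norm_square [symmetric] by simp
  finally have "(1 + of_real (t\<^sup>2) * c) * (1 + of_real (t\<^sup>2) * cnj c)
      = of_real (1 + 2 * Re c * t\<^sup>2 + (cmod c)\<^sup>2 * t ^ 4)" .
  moreover have "(- \<i> * of_real t)\<^sup>2 = - complex_of_real (t\<^sup>2)"
    by (simp add: power_mult_distrib)
  ultimately show ?thesis
    unfolding quad_factor_def quad_mgf_def by (simp add: exp_of_real [symmetric])
qed

text \<open>
  The hypothesis on \<open>c\<close> gives \<open>Re c \<ge> 0\<close> and \<open>|c|\<^sup>2 \<le> 2 (Re c)\<^sup>2\<close>, so the quartic term of the moment generating function is at
  most half the square of its quadratic term \<open>a\<close> and \<open>1 + a + a\<^sup>2 / 2 \<le> exp a\<close> gives the upper bound. The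
  lower bound is the linear part of the product in \<open>t\<^sup>2\<close>.
\<close>

lemma quad_mgf_bounds:
  assumes c: "sqrt 2 / 2 * cmod c \<le> Re c"
  shows "1 + quad_var c * t\<^sup>2 / 2 \<le> quad_mgf c t" "quad_mgf c t \<le> exp (quad_var c * t\<^sup>2 / 2)"
proof -
  define a where "a = 2 * Re c * t\<^sup>2"
  define b where "b = 5 / 2 * cmod c * t\<^sup>2"
  have Re0: "0 \<le> Re c" using c by (rule order_trans[rotated]) simp
  then have a0: "0 \<le> a" by (simp add: a_def)
  have b0: "0 \<le> b" by (simp add: b_def)
  have ab: "quad_var c * t\<^sup>2 / 2 = a + b"
    by (simp add: quad_var_def a_def b_def algebra_simps)
  have "(sqrt 2 / 2 * cmod c)\<^sup>2 \<le> (Re c)\<^sup>2"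
    using c by (intro power_mono) auto
  then have "(cmod c)\<^sup>2 \<le> 2 * (Re c)\<^sup>2"
    by (simp add: power_mult_distrib power_divide)
  from mult_right_mono[OF this, of "t ^ 4"]
  have "(cmod c)\<^sup>2 * t ^ 4 \<le> a\<^sup>2 / 2"
    by (simp add: a_def power_mult_distrib mult_ac)
  then have "1 + a + (cmod c)\<^sup>2 * t ^ 4 \<le> exp a"
    using exp_lower_Taylor_quadratic[OF a0] by linarith
  then show "quad_mgf c t \<le> exp (quad_var c * t\<^sup>2 / 2)"
    unfolding ab exp_add quad_mgf_def a_def b_def by (intro mult_right_mono) auto
  have "1 + (a + b) \<le> (1 + a) * (1 + b)"
    using a0 b0 by (simp add: algebra_simps)
  also have "\<dots> \<le> (1 + a + (cmod c)\<^sup>2 * t ^ 4) * exp b"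
    using a0 b0 by (intro mult_mono) (auto simp: exp_ge_add_one_self)
  finally show "1 + quad_var c * t\<^sup>2 / 2 \<le> quad_mgf c t"
    unfolding ab by (simp add: quad_mgf_def a_def b_def)
qed

section \<open>The infinite product\<close>

lemma sum_le_prod_one_plus:
  fixes a b :: "'i \<Rightarrow> real"
  assumes "\<And>i. i \<in> I \<Longrightarrow> 0 \<le> a i" "\<And>i. i \<in> I \<Longrightarrow> 1 + a i \<le> b i"
  shows "1 + sum a I \<le> prod b I"
  using assms
proof (induction I rule: infinite_finite_induct)
  case (insert i I)
  have "1 + sum a (insert i I) \<le> (1 + a i) * (1 + sum a I)"
    using insert by (simp add: algebra_simps sum_nonneg)
  also have "\<dots> \<le> b i * prod b I"
    using insert by (intro mult_mono) (auto intro!: add_nonneg_nonneg sum_nonneg order_trans[of 0 "1 + a i" "b i"])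
  finally show ?case using insert by simp
qed auto

text \<open>
  Convergence is meant in the strict sense, with a nonzero limit after omitting finitely many factors;
  this is what confines the zeros of the product to the zeros of its factors.
\<close>

lemma convergent_prod_quad_factor:
  assumes "summable (\<lambda>n. cmod (c n))"
  shows "convergent_prod (\<lambda>n. quad_factor (c n) w)"
proof -
  have lin: "convergent_prod (\<lambda>n. 1 - w\<^sup>2 * d n)" if "summable (\<lambda>n. cmod (d n))" for d
    using summable_mult[OF that, of "(cmod w)\<^sup>2"]
    by (intro abs_convergent_prod_imp_convergent_prod summable_imp_abs_convergent_prod)
       (simp add: norm_mult norm_power)
  have "summable (\<lambda>n. complex_of_real (cmod (c n)))"
    using assms by (rule summable_of_real)
  from summable_mult[OF this, of "of_real (- 5 / 2) * w\<^sup>2"]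
  have "summable (\<lambda>n. of_real (- 5 / 2 * cmod (c n)) * w\<^sup>2)"
    by (simp add: mult_ac)
  then have "convergent_prod (\<lambda>n. exp (of_real (- 5 / 2 * cmod (c n)) * w\<^sup>2))"
    by (rule convergent_prod_exp)
  moreover have "summable (\<lambda>n. cmod (cnj (c n)))"
    using assms by simp
  ultimately show ?thesis
    unfolding quad_factor_def by (intro convergent_prod_mult lin assms)
qed

lemma quad_factor_zeros:
  assumes "z \<noteq> 0"
  shows "quad_factor (1 / z\<^sup>2) w = 0 \<longleftrightarrow> w \<in> {z, - z, cnj z, - cnj z}"
proof -
  have "quad_factor (1 / z\<^sup>2) w = 0 \<longleftrightarrow> w\<^sup>2 = z\<^sup>2 \<or> w\<^sup>2 = (cnj z)\<^sup>2"
  proof -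
    have "1 - w\<^sup>2 * (1 / v\<^sup>2) = 0 \<longleftrightarrow> w\<^sup>2 = v\<^sup>2" if "v \<noteq> 0" for v
      using that by (auto simp: field_simps)
    from this[of z] this[of "cnj z"] show ?thesis
      using assms by (simp add: quad_factor_def)
  qed
  then show ?thesis by (simp add: power2_eq_iff)
qed

lemma finite_quad_factor_product_is_complex_char:
  fixes c :: "nat \<Rightarrow> complex"
  assumes "\<And>k. sqrt 2 / 2 * cmod (c k) \<le> Re (c k)"
  shows "\<exists>M. has_exp_moments M \<and> complex_char M = (\<lambda>w. \<Prod>k\<le>n. quad_factor (c k) w)"
proof (induction n)
  case 0
  show ?case
    using quad_factor_is_complex_char[OF assms[of 0]] by simp
next
  case (Suc n)
  then obtain M where M: "has_exp_moments M" "complex_char M = (\<lambda>w. \<Prod>k\<le>n. quad_factor (c k) w)"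
    by blast
  obtain N where N: "has_exp_moments N" "complex_char N = quad_factor (c (Suc n))"
    using quad_factor_is_complex_char[OF assms[of "Suc n"]] by blast
  have "complex_char (M \<star> N) = (\<lambda>w. \<Prod>k\<le>Suc n. quad_factor (c k) w)"
    using complex_char_convolution[OF M(1) N(1)] by (simp add: M(2) N(2) fun_eq_iff)
  then show ?case
    using has_exp_moments_convolution[OF M(1) N(1)] by blast
qed

text \<open>
  The distribution is the weak limit of the finite convolutions. Its symmetry and its zeros are read off
  the infinite product, and the two-sided estimate of its moment generating function is inherited from
  the partial products \<open>h\<close>, with \<open>s\<close> the sum of the variances.
\<close>

lemma infinite_quad_factor_product_distribution:
  assumes c: "\<And>k. sqrt 2 / 2 * cmod (c k) \<le> Re (c k)" and sum: "summable (\<lambda>k. cmod (c k))"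
  shows "\<exists>M. real_distribution M \<and> symmetric_distr M \<and> prob_space.strictly_subgaussian M (\<lambda>x. x) \<and>
           {w. complex_char M w = 0} = (\<Union>k. {w. quad_factor (c k) w = 0})"
proof -
  define P where "P n w = (\<Prod>k\<le>n. quad_factor (c k) w)" for n w
  define f where "f w = lim (\<lambda>n. P n w)" for w
  have lim: "(\<lambda>n. P n w) \<longlonglongrightarrow> f w" for w
    unfolding f_def P_def
    using convergent_prod_imp_convergent[OF convergent_prod_quad_factor[OF sum]]
    by (simp add: convergent_LIMSEQ_iff)
  obtain \<mu> where \<mu>: "\<And>n. has_exp_moments (\<mu> n)" and char\<mu>: "\<And>n. complex_char (\<mu> n) = P n"
    using finite_quad_factor_product_is_complex_char[of c, OF c] unfolding P_def[abs_def] by metis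

  have var0: "0 \<le> quad_var (c k)" for k
    using c[of k] order_trans[OF _ c[of k], of 0] by (simp add: quad_var_def)
  have var_sum: "summable (\<lambda>k. quad_var (c k))"
  proof (rule summable_comparison_test')
    show "summable (\<lambda>k. 9 * cmod (c k))" using sum by (rule summable_mult)
    show "norm (quad_var (c k)) \<le> 9 * cmod (c k)" for k
      using var0[of k] complex_Re_le_cmod[of "c k"] by (simp add: quad_var_def)
  qed
  define s where "s = (\<Sum>k. quad_var (c k))"
  define S where "S n = (\<Sum>k\<le>n. quad_var (c k))" for n
  define h where "h n t = (\<Prod>k\<le>n. quad_mgf (c k) t)" for n t
  have S_lim: "S \<longlonglongrightarrow> s"
    unfolding S_def[abs_def] s_def using summable_LIMSEQ'[OF var_sum] .
  have S_le: "S n \<le> s" for n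
    unfolding S_def s_def by (intro sum_le_suminf var_sum) (auto simp: var0)
  have P_imag: "P n (- \<i> * of_real t) = of_real (h n t)" for n t
    unfolding P_def h_def quad_factor_imaginary by simp
  have mgf\<mu>: "(\<integral>x. exp (t * x) \<partial>\<mu> n) = h n t" for n t
    using mgf_eq_complex_char[of "\<mu> n" t] unfolding char\<mu> P_imag by (simp only: of_real_eq_iff)
  have h_lower: "1 + S n * t\<^sup>2 / 2 \<le> h n t" for n t
  proof -
    have "1 + (\<Sum>k\<le>n. quad_var (c k) * t\<^sup>2 / 2) \<le> h n t"
      unfolding h_def using var0 quad_mgf_bounds(1)[OF c] by (intro sum_le_prod_one_plus) auto
    then show ?thesis
      by (simp only: S_def sum_distrib_right sum_divide_distrib)
  qed
  have h_upper: "h n t \<le> exp (s * t\<^sup>2 / 2)" for n t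
  proof -
    have "0 \<le> quad_mgf (c k) t" for k
      by (rule order_trans[OF _ quad_mgf_bounds(1)[OF c]]) (simp add: var0)
    then have "h n t \<le> (\<Prod>k\<le>n. exp (quad_var (c k) * t\<^sup>2 / 2))"
      unfolding h_def using quad_mgf_bounds(2)[OF c] by (intro prod_mono) auto
    also have "\<dots> = exp (S n * t\<^sup>2 / 2)"
      by (simp add: S_def exp_sum sum_distrib_right sum_divide_distrib)
    also have "\<dots> \<le> exp (s * t\<^sup>2 / 2)"
      using mult_right_mono[OF S_le, of "t\<^sup>2"] by simp
    finally show ?thesis .
  qed

  obtain M where M: "has_exp_moments M" and charM: "complex_char M = f"
    using complex_char_limit_exists[of \<mu> "\<lambda>t. exp (s * t\<^sup>2 / 2)" f] \<mu> h_upper lim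
    unfolding mgf\<mu> char\<mu> by blast
  have rd: "real_distribution M" using M by (simp add: has_exp_moments_def)
  have mgf_lim: "(\<lambda>n. h n t) \<longlonglongrightarrow> (\<integral>x. exp (t * x) \<partial>M)" for t
    using lim[of "- \<i> * of_real t"] mgf_eq_complex_char[of M t]
    unfolding P_imag charM by (simp only: tendsto_of_real_iff)

  have "f (- w) = f w" for w
    by (simp add: f_def P_def quad_factor_def)
  then have sym: "symmetric_distr M"
    by (intro symmetric_distr_if_even_complex_char rd) (simp add: charM)
  have "1 + s * t\<^sup>2 / 2 \<le> (\<integral>x. exp (t * x) \<partial>M)" for t
  proof (rule LIMSEQ_le[OF _ mgf_lim])
    show "(\<lambda>n. 1 + S n * t\<^sup>2 / 2) \<longlonglongrightarrow> 1 + s * t\<^sup>2 / 2"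
      by (intro tendsto_intros S_lim) simp
  qed (use h_lower in blast)
  moreover have "(\<integral>x. exp (t * x) \<partial>M) \<le> exp (s * t\<^sup>2 / 2)" for t
    by (rule LIMSEQ_le_const2[OF mgf_lim]) (use h_upper in auto)
  ultimately have "prob_space.strictly_subgaussian M (\<lambda>x. x)"
    by (intro strictly_subgaussian_if_mgf_between[OF M symmetric_distr_expectation_0[OF rd sym]])
  moreover have "complex_char M w = 0 \<longleftrightarrow> (\<exists>k. quad_factor (c k) w = 0)" for w
  proof -
    have "f w = 0 \<longleftrightarrow> (\<lambda>n. P n w) \<longlonglongrightarrow> 0"
      using lim[of w] LIMSEQ_unique by auto
    also have "\<dots> \<longleftrightarrow> (\<exists>k. quad_factor (c k) w = 0)"
      unfolding P_def by (rule convergent_prod_to_zero_iff[OF convergent_prod_quad_factor[OF sum]])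
    finally show ?thesis by (simp add: charM)
  qed
  ultimately show ?thesis
    using rd sym by (intro exI[of _ M]) auto
qed

theorem theorem1p5:
  fixes z :: "nat \<Rightarrow> complex" and N :: enat
  assumes nonzero: "\<And>n. enat n < N \<Longrightarrow> z n \<noteq> 0"
    and angle: "\<And>n. enat n < N \<Longrightarrow> \<bar>Arg (z n)\<bar> \<le> pi / 8"
    and summable: "(\<lambda>n. 1 / (cmod (z n))\<^sup>2) summable_on {n. enat n < N}"
  shows "\<exists>M :: real measure. real_distribution M \<and> symmetric_distr M \<and>
           prob_space.strictly_subgaussian M (\<lambda>x. x) \<and>
           {w. complex_char M w = 0} =
             (\<Union>n\<in>{n. enat n < N}. {z n, - z n, cnj (z n), - cnj (z n)})"
proof -
  define c where "c n = (if enat n < N then 1 / (z n)\<^sup>2 else 0)" for n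
  have "sqrt 2 / 2 * cmod (c n) \<le> Re (c n)" for n
    using Re_inverse_square_ge[OF nonzero angle, of n] by (auto simp: c_def)
  moreover have "summable (\<lambda>n. cmod (c n))"
  proof -
    have "(\<lambda>n. cmod (c n)) summable_on UNIV \<longleftrightarrow> (\<lambda>n. 1 / (cmod (z n))\<^sup>2) summable_on {n. enat n < N}"
      by (rule summable_on_cong_neutral) (auto simp: c_def norm_divide norm_power)
    then show ?thesis
      using summable by (simp add: summable_on_UNIV_nonneg_real_iff)
  qed
  moreover have "(\<Union>n. {w. quad_factor (c n) w = 0})
      = (\<Union>n\<in>{n. enat n < N}. {z n, - z n, cnj (z n), - cnj (z n)})"
  proof -
    have "{w. quad_factor (c n) w = 0}
        = (if enat n < N then {z n, - z n, cnj (z n), - cnj (z n)} else {})" for n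
    proof (cases "enat n < N")
      case True
      with quad_factor_zeros[OF nonzero[OF True]] show ?thesis
        by (auto simp: c_def)
    next
      case False
      then show ?thesis by (simp add: c_def quad_factor_def)
    qed
    then show ?thesis by (auto split: if_splits)
  qed
  ultimately show ?thesis
    using infinite_quad_factor_product_distribution[of c] by simp
qed

end
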